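(* Let $\Gamma$ be an abelian group and let $C$ be a finite inclusion-minimal generating set of the generalized dihedral group $\mathrm{Dih}(\Gamma)$. Then the Cayley graph $\mathrm{Cay}(\mathrm{Dih}(\Gamma),C)$ is $3$-colorable.
   Context: For an abelian group $\Gamma$ (written additively), the generalized dihedral group $\mathrm{Dih}(\Gamma)=\Gamma\rtimes\mathbb{Z}_2$ is the set $\Gamma\times\mathbb{Z}_2$ with multiplication $(g_1,0)*(g_2,t_2)=(g_1+g_2,t_2)$ and $(g_1,1)*(g_2,t_2)=(g_1-g_2,1+t_2)$ for all $g_1,g_2\in\Gamma$, $t_2\in\mathbb{Z}_2$. For a group $\Delta$ and a subset $C\subseteq\Delta$, the Cayley graph $\mathrm{Cay}(\Delta,C)$ is the undirected graph with vertex set $\Delta$ in which $a,b$ are adjacent if $a^{-1}b\in C$; it is undirected even if $C$ is not inverse-closed. *)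

theory Defs
  imports
    "HOL-Algebra.Elementary_Groups"
    "Graph_Theory.Pair_Digraph"
begin

text \<open>Abelian groups are written multiplicatively here, as is usual for the locale
  \<^locale>\<open>comm_group\<close>: g1 + g2 and g1 - g2 become products with g2 and with its inverse.\<close>

definition generalized_dihedral :: "('a, 'b) monoid_scheme \<Rightarrow> ('a \<times> int) monoid" where
  "generalized_dihedral \<Gamma> =
     \<lparr>carrier = carrier \<Gamma> \<times> carrier (integer_mod_group 2),
      monoid.mult = (\<lambda>(g1, t1) (g2, t2).
        (if t1 = 0 then g1 \<otimes>\<^bsub>\<Gamma>\<^esub> g2 else g1 \<otimes>\<^bsub>\<Gamma>\<^esub> inv\<^bsub>\<Gamma>\<^esub> g2,
         t1 \<otimes>\<^bsub>integer_mod_group 2\<^esub> t2)),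
      monoid.one = (\<one>\<^bsub>\<Gamma>\<^esub>, 0)\<rparr>"

definition minimal_generating_set :: "('a, 'b) monoid_scheme \<Rightarrow> 'a set \<Rightarrow> bool" where
  "minimal_generating_set \<Delta> C \<longleftrightarrow>
     C \<subseteq> carrier \<Delta> \<and> generate \<Delta> C = carrier \<Delta> \<and>
     (\<forall>D. D \<subset> C \<longrightarrow> generate \<Delta> D \<noteq> carrier \<Delta>)"

text \<open>An undirected graph is represented by its symmetric arc relation. Taking both
  disjuncts makes the relation symmetric without assuming that C is closed under inverses.\<close>

definition cayley_graph :: "('a, 'b) monoid_scheme \<Rightarrow> 'a set \<Rightarrow> 'a pair_pre_digraph" where
  "cayley_graph \<Delta> C =
     \<lparr>pverts = carrier \<Delta>,
      parcs = {(a, b). a \<in> carrier \<Delta> \<and> b \<in> carrier \<Delta> \<and>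
        (inv\<^bsub>\<Delta>\<^esub> a \<otimes>\<^bsub>\<Delta>\<^esub> b \<in> C \<or> inv\<^bsub>\<Delta>\<^esub> b \<otimes>\<^bsub>\<Delta>\<^esub> a \<in> C)}\<rparr>"

text \<open>A graph with a loop has no proper colouring in this sense.\<close>

definition colorable :: "'a pair_pre_digraph \<Rightarrow> nat \<Rightarrow> bool" where
  "colorable G k \<longleftrightarrow>
     (\<exists>f :: 'a \<Rightarrow> nat. (\<forall>v \<in> pverts G. f v < k) \<and> (\<forall>(u, v) \<in> parcs G. f u \<noteq> f v))"

lemma group_generalized_dihedral:
  assumes "comm_group \<Gamma>"
  shows "group (generalized_dihedral \<Gamma>)"
proof -
  interpret comm_group \<Gamma> by (rule assms)
  have c2: "t \<in> carrier (integer_mod_group 2) \<longleftrightarrow> t = 0 \<or> t = 1" for t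
    by (auto simp: carrier_integer_mod_group)
  show ?thesis
  proof (rule groupI)
    fix x assume "x \<in> carrier (generalized_dihedral \<Gamma>)"
    then obtain g t where x: "x = (g, t)" "g \<in> carrier \<Gamma>" "t = 0 \<or> t = 1"
      by (auto simp: generalized_dihedral_def c2)
    show "\<exists>y\<in>carrier (generalized_dihedral \<Gamma>).
      y \<otimes>\<^bsub>generalized_dihedral \<Gamma>\<^esub> x = \<one>\<^bsub>generalized_dihedral \<Gamma>\<^esub>"
      by (rule bexI[where x = "if t = 0 then (inv\<^bsub>\<Gamma>\<^esub> g, 0) else (g, 1)"])
        (use x in \<open>auto simp: generalized_dihedral_def c2 mult_integer_mod_group\<close>)
  qed (auto simp: generalized_dihedral_def c2 mult_integer_mod_group m_assoc inv_mult
        split: if_splits)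
qed

lemma symmetric_cayley_graph: "symmetric (with_proj (cayley_graph \<Delta> C))"
  unfolding symmetric_def arcs_ends_def arc_to_ends_def
  by (auto simp: cayley_graph_def sym_def)

lemma wf_cayley_graph: "pair_wf_digraph (cayley_graph \<Delta> C)"
  by unfold_locales (auto simp: cayley_graph_def)

lemma (in group) one_notin_minimal_generating_set:
  assumes "minimal_generating_set G C"
  shows "\<one> \<notin> C"
proof
  assume one: "\<one> \<in> C"
  have "generate G C \<subseteq> generate G (C - {\<one>})"
  proof
    fix x assume "x \<in> generate G C"
    then show "x \<in> generate G (C - {\<one>})"
    proof induction
      case (incl h) then show ?case
        by (cases "h = \<one>") (auto intro: generate.intros)
    next
      case (inv h) then show ?case
        by (cases "h = \<one>") (auto intro: generate.intros)
    qed (auto intro: generate.intros)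
  qed
  moreover have "generate G (C - {\<one>}) \<subseteq> generate G C"
    by (rule mono_generate) auto
  ultimately show False
    using assms one unfolding minimal_generating_set_def by blast
qed

end

theory Submission
  imports Defs "HOL-Algebra.FiniteProduct"
begin

text \<open>
  Write \<open>\<Gamma>\<close> additively and fix a reflection (b, 1) in C. By minimality, the a with (a, 0) in C
  together with the y - b with (y, 1) in C, y distinct from b, form an independent generating
  family of \<open>\<Gamma>\<close>. Suppose that \<open>\<chi>\<close> is a character of \<open>\<Gamma>\<close> with values in the reals modulo 1 that is
  within 1/6 of 1/2 at each a and within 1/6 of 0 at each y - b. Give (x, 0) the value \<open>\<chi>\<close>(x) and
  (x, 1) the value \<open>\<chi>\<close>(x - b) + 1/2. Adjacent vertices then have values at circular distance at
  least 1/3, so the three half-open thirds of the circle are the colour classes.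

  Such a character is a choice of phases for the family that is integral on its lattice of relations.
  No relation has a coefficient 1. A member whose coefficients are all even can take the half-integer
  target itself as its phase. The other members are treated one at a time: the least positive
  coefficient m of the new member is at least 3 (2 together with an odd coefficient would
  produce 1), so the admissible phases are spaced by at most 1/3.
\<close>

section \<open>Real phases that are integral on a lattice of integer relations\<close>

text \<open>Admitting one more nonzero coordinate imposes just one new integrality condition:
  Euclidean division by a relation with least positive coefficient there reduces every other
  relation to one that is already settled.\<close>

lemma integral_phases:
  fixes L :: "('i \<Rightarrow> int) set" and c :: "'i \<Rightarrow> real"
  assumes J: "finite J"
    and comb: "\<And>k l q. k \<in> L \<Longrightarrow> l \<in> L \<Longrightarrow> (\<lambda>j. k j - q * l j) \<in> L"
    and unit: "\<And>k j. k \<in> L \<Longrightarrow> j \<in> J \<Longrightarrow> k j \<noteq> 1"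
    and c: "\<And>j. j \<in> J \<Longrightarrow> 2 * c j \<in> \<int>"
  obtains t where "\<And>j. j \<in> J \<Longrightarrow> \<bar>t j - c j\<bar> \<le> 1/6"
    and "\<And>k. k \<in> L \<Longrightarrow> (\<Sum>j\<in>J. of_int (k j) * t j) \<in> \<int>"
proof -
  define Od where "Od = {j \<in> J. \<exists>k\<in>L. odd (k j)}"
  have fin: "finite Od" using J by (simp add: Od_def)
  \<comment> \<open>Integrality is asserted only for relations vanishing on \<open>Od - F\<close>.
    The case \<open>F = Od\<close> covers all of \<open>L\<close>; for empty \<open>F\<close> the
    remaining coefficients are even, so \<open>t = c\<close> works.\<close>
  have "\<exists>t. (\<forall>j\<in>J. \<bar>t j - c j\<bar> \<le> 1/6) \<and>
      (\<forall>k\<in>L. (\<forall>j\<in>Od - F. k j = 0) \<longrightarrow> (\<Sum>j\<in>J. of_int (k j) * t j) \<in> \<int>)"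
    if "F \<subseteq> Od" for F
    using finite_subset[OF that fin] that
  proof (induction F rule: finite_induct)
    case empty
    have "of_int (k j) * c j \<in> \<int>" if "k \<in> L" "\<forall>j\<in>Od. k j = 0" "j \<in> J" for k j
    proof (cases "j \<in> Od")
      case True
      then show ?thesis using that by simp
    next
      case False
      then have "even (k j)" using that by (auto simp: Od_def)
      then obtain q where "k j = 2 * q" by (rule evenE)
      then have "of_int (k j) * c j = of_int q * (2 * c j)" by simp
      also have "\<dots> \<in> \<int>" by (intro Ints_mult c \<open>j \<in> J\<close>) simp
      finally show ?thesis .
    qed
    then show ?case by (intro exI[of _ c]) (auto intro!: Ints_sum)
  next
    case (insert i F)
    obtain t where t: "\<And>j. j \<in> J \<Longrightarrow> \<bar>t j - c j\<bar> \<le> 1/6"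
      and tL: "\<And>k. k \<in> L \<Longrightarrow> \<forall>j\<in>Od - F. k j = 0 \<Longrightarrow> (\<Sum>j\<in>J. of_int (k j) * t j) \<in> \<int>"
      using insert.IH insert.prems by (metis insert_subset)
    have iJ: "i \<in> J" "i \<in> Od" using insert by (auto simp: Od_def)
    define M where "M = {k \<in> L. \<forall>j\<in>Od - insert i F. k j = 0}"
    have Mcomb: "(\<lambda>j. k j - q * l j) \<in> M" if "k \<in> M" "l \<in> M" for k l q
      using that comb by (auto simp: M_def)
    show ?case
    proof (cases "\<forall>k\<in>M. k i = 0")
      case True
      have "(\<Sum>j\<in>J. of_int (k j) * t j) \<in> \<int>"
        if "k \<in> L" "\<forall>j\<in>Od - insert i F. k j = 0" for k
      proof (rule tL[OF that(1)])
        have "k i = 0" using True that by (auto simp: M_def)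
        then show "\<forall>j\<in>Od - F. k j = 0" using that(2) by auto
      qed
      then show ?thesis using t by (intro exI[of _ t]) blast
    next
      case False
      then obtain k0 where k0: "k0 \<in> M" "k0 i \<noteq> 0" by auto
      define P where "P = (\<lambda>n::nat. 0 < n \<and> (\<exists>k\<in>M. k i = int n))"
      have "\<exists>n. P n"
      proof (cases "k0 i > 0")
        case True
        then show ?thesis using k0 unfolding P_def by (intro exI[of _ "nat (k0 i)"]) auto
      next
        case False
        \<comment> \<open>Closure is available for \<open>k - q * l\<close> only, so the negative of
          \<open>k0\<close> is obtained as \<open>k0 - 2 * k0\<close>.\<close>
        then show ?thesis using k0 Mcomb[OF k0(1) k0(1), of 2] unfolding P_def
          by (intro exI[of _ "nat (- k0 i)"] conjI bexI[of _ "\<lambda>j. k0 j - 2 * k0 j"]) auto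
      qed
      define m where "m = (LEAST n. P n)"
      have "P m" using \<open>\<exists>n. P n\<close> unfolding m_def by (rule LeastI_ex)
      then obtain r where m: "m > 0" and r: "r \<in> M" "r i = int m" by (auto simp: P_def)
      have least: "m \<le> n" if "P n" for n using that unfolding m_def by (rule Least_le)
      have "m \<noteq> 1" using unit[of r i] r iJ by (auto simp: M_def)
      moreover have "m \<noteq> 2"
      proof
        assume "m = 2"
        \<comment> \<open>The relation \<open>l\<close> with odd coefficient comes from all of
          \<open>L\<close> and need not lie in \<open>M\<close>; \<open>unit\<close> holds on all of
          \<open>L\<close>, which is enough for the contradiction.\<close>
        obtain l where l: "l \<in> L" "odd (l i)" using iJ by (auto simp: Od_def)
        then have "(\<lambda>j. l j - (l i div 2) * r j) \<in> L" using r comb by (auto simp: M_def)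
        moreover have "l i - (l i div 2) * r i = 1"
          using l r \<open>m = 2\<close> by (auto elim!: oddE)
        ultimately show False using unit[of "\<lambda>j. l j - (l i div 2) * r j" i] iJ by simp
      qed
      ultimately have m3: "m \<ge> 3" using m by simp
      define S where "S = (\<Sum>j\<in>J - {i}. of_int (r j) * t j)"
      \<comment> \<open>Relation \<open>r\<close> is integral under the new phase \<open>a\<close>
        exactly when \<open>m * a + S\<close> is an integer. The ceiling picks the first such
        \<open>a\<close> not below \<open>c i - 1/6\<close>; rounding moves it by at most
        \<open>1/m\<close>, hence by at most 1/3, the length of the allowed interval.\<close>
      define n where "n = \<lceil>real m * (c i - 1/6) + S\<rceil>"
      define a where "a = (of_int n - S) / real m"
      have ma: "real m * a = of_int n - S" using m by (simp add: a_def)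
      have "real m * (c i - 1/6) \<le> real m * a"
        unfolding ma n_def by linarith
      then have lo: "c i - 1/6 \<le> a" using m by simp
      have "real m * a \<le> real m * (c i - 1/6) + 1"
        unfolding ma n_def by linarith
      also have "\<dots> \<le> real m * (c i - 1/6) + real m * (1/3)" using m3 by simp
      also have "\<dots> = real m * (c i + 1/6)" by (simp add: algebra_simps)
      finally have "a \<le> c i + 1/6" using m by simp
      with lo have ai: "\<bar>a - c i\<bar> \<le> 1/6" by linarith
      let ?t = "t(i := a)"
      have split: "(\<Sum>j\<in>J. of_int (k j) * ?t j)
          = of_int (k i) * a + (\<Sum>j\<in>J - {i}. of_int (k j) * t j)" for k :: "'i \<Rightarrow> int"
        using J iJ by (simp add: sum.remove)
      have rt: "(\<Sum>j\<in>J. of_int (r j) * ?t j) \<in> \<int>"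
        unfolding split using r ma by (simp add: S_def)
      have "(\<Sum>j\<in>J. of_int (k j) * ?t j) \<in> \<int>" if k: "k \<in> M" for k
      proof -
        define q where "q = k i div int m"
        \<comment> \<open>The remainder of \<open>k\<close> modulo \<open>r\<close>. Minimality of
          \<open>m\<close> forces its coefficient at \<open>i\<close> to be 0, so the induction
          hypothesis applies to it and the change of phase at \<open>i\<close> does not affect its
          sum.\<close>
        define l where "l = (\<lambda>j. k j - q * r j)"
        have l: "l \<in> M" unfolding l_def using k r by (intro Mcomb)
        have li: "l i = k i mod int m"
          by (simp add: l_def q_def r minus_div_mult_eq_mod)
        have l0: "l i = 0"
        proof (rule ccontr)
          assume "l i \<noteq> 0"
          moreover have "0 \<le> l i" "l i < int m" using m by (simp_all add: li)
          ultimately have "P (nat (l i))" using l by (auto simp: P_def)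
          from least[OF this] \<open>l i < int m\<close> m show False by linarith
        qed
        have "(\<Sum>j\<in>J. of_int (l j) * t j) \<in> \<int>"
          using l l0 by (intro tL) (auto simp: M_def)
        moreover have "(\<Sum>j\<in>J. of_int (l j) * t j) = (\<Sum>j\<in>J. of_int (l j) * ?t j)"
          by (rule sum.cong) (use l0 in auto)
        moreover have "(\<Sum>j\<in>J. of_int (k j) * ?t j)
            = (\<Sum>j\<in>J. of_int (l j) * ?t j) + of_int q * (\<Sum>j\<in>J. of_int (r j) * ?t j)"
          unfolding sum_distrib_left sum.distrib[symmetric]
          by (rule sum.cong) (simp_all add: l_def algebra_simps del: fun_upd_apply)
        ultimately show ?thesis using rt by simp
      qed
      then show ?thesis
        using t ai by (intro exI[of _ ?t]) (auto simp: M_def)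
    qed
  qed
  from this[OF subset_refl] show ?thesis using that by auto
qed

section \<open>Three colours on the circle of reals modulo 1\<close>

text \<open>The index of the half-open third of the circle that contains \<open>x\<close> modulo 1.
  Half-openness keeps fractional parts within one third strictly less than 1/3 apart.\<close>

definition third :: "real \<Rightarrow> nat" where
  "third x = nat \<lfloor>3 * frac x\<rfloor>"

lemma third_less: "third x < 3"
proof -
  have "\<lfloor>3 * frac x\<rfloor> < 3" using frac_lt_1[of x] by (simp add: floor_less_iff)
  then show ?thesis unfolding third_def by linarith
qed

text \<open>Equal colours put the fractional parts at distance below 1/3. Their difference is
  \<open>z + p\<close> with \<open>p\<close> an integer and \<open>z\<close> between 1/3 and 2/3,
  which would place \<open>p\<close> strictly between -1 and 0.\<close>

lemma third_neq:
  assumes z: "y - x - z \<in> \<int>" and d: "\<bar>z - 1/2\<bar> \<le> 1/6"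
  shows "third x \<noteq> third y"
proof
  assume "third x = third y"
  moreover have "0 \<le> \<lfloor>3 * frac x\<rfloor>" "0 \<le> \<lfloor>3 * frac y\<rfloor>"
    by (simp_all add: frac_ge_0)
  ultimately have "\<lfloor>3 * frac x\<rfloor> = \<lfloor>3 * frac y\<rfloor>" unfolding third_def by linarith
  then have lt: "\<bar>frac y - frac x\<bar> < 1/3" by linarith
  from z obtain n where "y - x - z = of_int n" by (auto elim: Ints_cases)
  then have "frac y - frac x = z + of_int (n - \<lfloor>y\<rfloor> + \<lfloor>x\<rfloor>)" by (simp add: frac_def)
  then obtain p :: int where p: "frac y - frac x = z + of_int p" by blast
  have "real_of_int p < of_int 0" "of_int (- 1) < real_of_int p"
    using p lt d by linarith+
  then have "p < 0" "- 1 < p" unfolding of_int_less_iff by simp_all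
  then show False by linarith
qed

section \<open>Integer combinations in an abelian group\<close>

context comm_group
begin

text \<open>For finite \<open>J\<close> and \<open>e\<close> with values in the group, this is the
  homomorphism from integer vectors that sends the unit vector at \<open>j\<close> to
  \<open>e j\<close>. Its kernel is the lattice of relations of the family.\<close>

definition int_comb :: "('i \<Rightarrow> 'a) \<Rightarrow> 'i set \<Rightarrow> ('i \<Rightarrow> int) \<Rightarrow> 'a" where
  "int_comb e J k = (\<Otimes>j\<in>J. e j [^] k j)"

lemma int_comb_closed:
  assumes "e \<in> J \<rightarrow> carrier G"
  shows "int_comb e J k \<in> carrier G"
  unfolding int_comb_def by (rule finprod_closed) (use assms in auto)

lemma int_comb_add:
  assumes "e \<in> J \<rightarrow> carrier G"
  shows "int_comb e J (\<lambda>j. k j + l j) = int_comb e J k \<otimes> int_comb e J l"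
proof -
  have "int_comb e J (\<lambda>j. k j + l j) = (\<Otimes>j\<in>J. e j [^] k j \<otimes> e j [^] l j)"
    unfolding int_comb_def
    by (rule finprod_cong') (use assms in \<open>auto simp: int_pow_mult Pi_iff\<close>)
  also have "\<dots> = int_comb e J k \<otimes> int_comb e J l"
    unfolding int_comb_def by (rule finprod_multf) (use assms in auto)
  finally show ?thesis .
qed

lemma int_comb_scale:
  assumes "e \<in> J \<rightarrow> carrier G"
  shows "int_comb e J (\<lambda>j. q * k j) = int_comb e J k [^] q"
proof (cases "finite J")
  case True
  then show ?thesis using assms unfolding int_comb_def
  proof (induction J rule: finite_induct)
    case (insert i J)
    have "(\<lambda>j. e j [^] (k j * q)) \<in> J \<rightarrow> carrier G" "(\<lambda>j. e j [^] k j) \<in> J \<rightarrow> carrier G"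
      using insert.prems by auto
    then show ?case using insert
      by (simp add: int_pow_distrib int_pow_pow Pi_def mult.commute)
  qed simp
qed (simp add: int_comb_def)

lemma int_comb_single:
  assumes "e \<in> J \<rightarrow> carrier G" "finite J" "i \<in> J"
  shows "int_comb e J (\<lambda>j. if j = i then q else 0) = e i [^] q"
proof -
  have "int_comb e J (\<lambda>j. if j = i then q else 0)
      = (\<Otimes>j\<in>J. if i = j then e j [^] q else \<one>)"
    unfolding int_comb_def by (rule finprod_cong') (use assms in \<open>auto simp: Pi_iff\<close>)
  also have "\<dots> = e i [^] q"
    by (rule finprod_singleton) (use assms in \<open>auto simp: Pi_iff\<close>)
  finally show ?thesis .
qed

text \<open>Restricting the condition to nonzero coefficients lets the lemma apply to a combination
  that omits a member lying outside \<open>H\<close>.\<close>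

lemma int_comb_in_subgroup:
  assumes "finite J" "subgroup H G" "\<And>j. j \<in> J \<Longrightarrow> k j \<noteq> 0 \<Longrightarrow> e j \<in> H"
  shows "int_comb e J k \<in> H"
  using assms(1,3) unfolding int_comb_def
proof (induction J rule: finite_induct)
  case empty
  then show ?case using assms(2) by (simp add: subgroup.one_closed)
next
  case (insert i J)
  have H: "e j [^] k j \<in> H" if "j \<in> insert i J" for j
    using insert.prems[OF that] assms(2)
    by (cases "k j = 0") (auto intro: subgroup_int_pow_closed subgroup.one_closed)
  then have "e j [^] k j \<in> carrier G" if "j \<in> insert i J" for j
    using that subgroup.mem_carrier[OF assms(2)] by blast
  then show ?case using insert H by (auto simp: Pi_def intro: subgroup.m_closed[OF assms(2)])
qed

lemma subgroup_range_int_comb: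
  assumes e: "e \<in> J \<rightarrow> carrier G"
  shows "subgroup (range (int_comb e J)) G"
proof (rule subgroupI)
  fix a b assume "a \<in> range (int_comb e J)" "b \<in> range (int_comb e J)"
  then show "a \<otimes> b \<in> range (int_comb e J)"
    by (auto simp: int_comb_add[OF e, symmetric])
next
  fix a assume "a \<in> range (int_comb e J)"
  then obtain k where k: "a = int_comb e J k" by auto
  have "int_comb e J (\<lambda>j. -1 * k j) = inv a"
    unfolding int_comb_scale[OF e] k using int_comb_closed[OF e]
    by (simp add: int_pow_neg)
  then show "inv a \<in> range (int_comb e J)" by (metis rangeI)
qed (use int_comb_closed[OF e] in auto)

section \<open>Characters modulo 1 with approximately prescribed values\<close>

text \<open>Phases integral on the kernel of \<open>int_comb\<close> define a map on the group that
  is well defined and additive modulo 1. The character is represented by a real-valued function, so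
  its properties are stated up to integers. Independence is phrased by a separating subgroup, the
  form in which minimality supplies it.\<close>

lemma character_near_half_integers:
  fixes e :: "'i \<Rightarrow> 'a" and c :: "'i \<Rightarrow> real"
  assumes e: "e \<in> J \<rightarrow> carrier G" and J: "finite J"
    and gen: "carrier G \<subseteq> range (int_comb e J)"
    and indep: "\<And>j. j \<in> J \<Longrightarrow> \<exists>H. subgroup H G \<and> e ` (J - {j}) \<subseteq> H \<and> e j \<notin> H"
    and c: "\<And>j. j \<in> J \<Longrightarrow> 2 * c j \<in> \<int>"
  obtains \<chi> where "\<And>x y. x \<in> carrier G \<Longrightarrow> y \<in> carrier G \<Longrightarrow> \<chi> (x \<otimes> y) - \<chi> x - \<chi> y \<in> \<int>"
    and "\<And>j. j \<in> J \<Longrightarrow> \<exists>z. \<chi> (e j) - z \<in> \<int> \<and> \<bar>z - c j\<bar> \<le> 1/6"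
proof -
  define L where "L = {k. int_comb e J k = \<one>}"
  have sub: "int_comb e J (\<lambda>j. k j - q * l j) = int_comb e J k \<otimes> int_comb e J l [^] (- q)" for k l q
    using int_comb_add[OF e, of k "\<lambda>j. (-q) * l j"] int_comb_scale[OF e, of "-q" l] by simp
  have comb: "(\<lambda>j. k j - q * l j) \<in> L" if "k \<in> L" "l \<in> L" for k l q
    using that by (simp add: L_def sub)
  have unit: "k j \<noteq> 1" if "k \<in> L" "j \<in> J" for k j
  proof
    assume kj: "k j = 1"
    obtain H where H: "subgroup H G" "e ` (J - {j}) \<subseteq> H" "e j \<notin> H" using indep \<open>j \<in> J\<close> by blast
    \<comment> \<open>Subtracting the relation \<open>k\<close> from the unit vector at
      \<open>j\<close> keeps the value \<open>e j\<close> but makes the coefficient at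
      \<open>j\<close> zero, so \<open>e j\<close> would be a combination of the other
      members.\<close>
    define k' where "k' = (\<lambda>i. (if i = j then 1 else 0) - 1 * k i)"
    have "int_comb e J k' = e j"
      unfolding k'_def sub int_comb_single[OF e J \<open>j \<in> J\<close>]
      using that funcset_mem[OF e] by (simp add: L_def int_pow_1)
    moreover have "int_comb e J k' \<in> H"
      by (rule int_comb_in_subgroup[OF J H(1)]) (use H(2) kj in \<open>auto simp: k'_def split: if_splits\<close>)
    ultimately show False using H by simp
  qed
  obtain t where t: "\<And>j. j \<in> J \<Longrightarrow> \<bar>t j - c j\<bar> \<le> 1/6"
    and tL: "\<And>k. k \<in> L \<Longrightarrow> (\<Sum>j\<in>J. of_int (k j) * t j) \<in> \<int>"
    by (rule integral_phases[of J L c]) (use J comb unit c in blast)+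
  define T where "T = (\<lambda>k. \<Sum>j\<in>J. of_int (k j) * t j)"
  have Tsub: "T k - T l \<in> \<int>" if "int_comb e J k = int_comb e J l" for k l
  proof -
    have "(\<lambda>j. k j - 1 * l j) \<in> L"
      unfolding L_def mem_Collect_eq sub using that int_comb_closed[OF e]
      by (simp add: int_pow_neg)
    from tL[OF this] show ?thesis by (simp add: T_def sum_subtractf left_diff_distrib)
  qed
  \<comment> \<open>An arbitrary choice of coefficients; by \<open>Tsub\<close> another choice
    changes \<open>T\<close> only by an integer.\<close>
  define rep where "rep = (\<lambda>x. SOME k. int_comb e J k = x)"
  have rep: "int_comb e J (rep x) = x" if x: "x \<in> carrier G" for x
  proof -
    from gen x obtain k where "int_comb e J k = x" by blast
    then show ?thesis unfolding rep_def by (rule someI[of "\<lambda>k. int_comb e J k = x"])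
  qed
  show ?thesis
  proof (rule that[of "\<lambda>x. T (rep x)"])
    fix x y assume xy: "x \<in> carrier G" "y \<in> carrier G"
    have "T (rep (x \<otimes> y)) - T (\<lambda>j. rep x j + rep y j) \<in> \<int>"
      by (rule Tsub) (use xy in \<open>simp add: rep int_comb_add[OF e]\<close>)
    moreover have "T (\<lambda>j. rep x j + rep y j) = T (rep x) + T (rep y)"
      by (simp add: T_def sum.distrib distrib_right)
    ultimately show "T (rep (x \<otimes> y)) - T (rep x) - T (rep y) \<in> \<int>" by (simp add: algebra_simps)
  next
    fix j assume j: "j \<in> J"
    then have ej: "e j \<in> carrier G" using e by auto
    have "T (rep (e j)) - T (\<lambda>i. if i = j then 1 else 0) \<in> \<int>"
      by (rule Tsub) (use ej in \<open>simp add: rep int_comb_single[OF e J j]\<close>)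
    moreover have "T (\<lambda>i. if i = j then 1 else 0) = t j"
      unfolding T_def using J j by (simp add: if_distrib if_distribR cong: if_cong)
    ultimately show "\<exists>z. T (rep (e j)) - z \<in> \<int> \<and> \<bar>z - c j\<bar> \<le> 1/6" using t[OF j] by auto
  qed
qed

end

section \<open>Rotations, reflections and subgroups of the generalized dihedral group\<close>

lemma dihedral_simps:
  shows "(x, s) \<in> carrier (generalized_dihedral \<Gamma>) \<longleftrightarrow> x \<in> carrier \<Gamma> \<and> (s = 0 \<or> s = 1)"
    and "\<one>\<^bsub>generalized_dihedral \<Gamma>\<^esub> = (\<one>\<^bsub>\<Gamma>\<^esub>, 0)"
    and "(x, 0) \<otimes>\<^bsub>generalized_dihedral \<Gamma>\<^esub> (y, r) = (x \<otimes>\<^bsub>\<Gamma>\<^esub> y, r mod 2)"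
    and "(x, 1) \<otimes>\<^bsub>generalized_dihedral \<Gamma>\<^esub> (y, r) = (x \<otimes>\<^bsub>\<Gamma>\<^esub> inv\<^bsub>\<Gamma>\<^esub> y, (1 + r) mod 2)"
  by (auto simp: generalized_dihedral_def carrier_integer_mod_group mult_integer_mod_group)

context comm_group
begin

abbreviation Dih :: "('a \<times> int) monoid" where
  "Dih \<equiv> generalized_dihedral G"

lemma inv_rotation:
  assumes "x \<in> carrier G"
  shows "inv\<^bsub>Dih\<^esub> (x, 0) = (inv x, 0)"
  by (rule group.inv_equality[OF group_generalized_dihedral[OF comm_group_axioms]])
    (use assms in \<open>auto simp: dihedral_simps\<close>)

lemma inv_reflection:
  assumes "x \<in> carrier G"
  shows "inv\<^bsub>Dih\<^esub> (x, 1) = (x, 1)"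
  by (rule group.inv_equality[OF group_generalized_dihedral[OF comm_group_axioms]])
    (use assms in \<open>auto simp: dihedral_simps\<close>)

text \<open>Carries a subgroup of \<open>Dih\<close> that misses a generator down to the separating
  subgroup required for independence.\<close>

lemma subgroup_rotations:
  assumes "subgroup S Dih"
  shows "subgroup {x. (x, 0) \<in> S} G"
proof (rule subgroupI)
  show "{x. (x, 0) \<in> S} \<subseteq> carrier G"
    using subgroup.subset[OF assms] by (auto simp: dihedral_simps dest!: subsetD)
  show "{x. (x, 0) \<in> S} \<noteq> {}"
    using subgroup.one_closed[OF assms] by (auto simp: dihedral_simps)
next
  fix a assume a: "a \<in> {x. (x, 0) \<in> S}"
  then have "a \<in> carrier G"
    using subgroup.mem_carrier[OF assms, of "(a, 0)"] by (simp add: dihedral_simps)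
  then show "inv a \<in> {x. (x, 0) \<in> S}"
    using a subgroup.m_inv_closed[OF assms, of "(a, 0)"] by (simp add: inv_rotation)
next
  fix a b assume "a \<in> {x. (x, 0) \<in> S}" "b \<in> {x. (x, 0) \<in> S}"
  then show "a \<otimes> b \<in> {x. (x, 0) \<in> S}"
    using subgroup.m_closed[OF assms, of "(a, 0)" "(b, 0)"] by (simp add: dihedral_simps)
qed

text \<open>In a product of two reflections from the coset of \<open>b\<close> the factor
  \<open>b\<close> cancels, which leaves a rotation by an element of \<open>H\<close>. This lifts
  the span of the family to a subgroup of \<open>Dih\<close> that can be compared with
  \<open>C\<close>.\<close>

lemma subgroup_rotations_reflections:
  assumes H: "subgroup H G" and b: "b \<in> carrier G"
  shows "subgroup (H \<times> {0} \<union> (\<lambda>h. (h \<otimes> b, 1)) ` H) Dih" (is "subgroup ?S Dih")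
proof -
  interpret D: group Dih by (rule group_generalized_dihedral) (rule comm_group_axioms)
  have Hc: "h \<in> carrier G" if "h \<in> H" for h using that by (rule subgroup.mem_carrier[OF H])
  have mult: "h \<otimes> k \<in> H" "h \<otimes> inv k \<in> H" if "h \<in> H" "k \<in> H" for h k
    using that H by (auto intro: subgroup.m_closed subgroup.m_inv_closed)
  show ?thesis
  proof (rule D.subgroupI)
    show "?S \<subseteq> carrier Dih" using Hc b by (auto simp: dihedral_simps)
    show "?S \<noteq> {}" using subgroup.one_closed[OF H] by auto
  next
    fix p assume "p \<in> ?S"
    then show "inv\<^bsub>Dih\<^esub> p \<in> ?S"
      using Hc b subgroup.m_inv_closed[OF H] by (auto simp: inv_rotation inv_reflection)
  next
    fix p q assume pq: "p \<in> ?S" "q \<in> ?S"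
    have swap: "h \<otimes> b \<otimes> inv k = h \<otimes> inv k \<otimes> b" if "h \<in> H" "k \<in> H" for h k
      using Hc[OF that(1)] Hc[OF that(2)] b by (simp add: m_ac)
    have cancel: "h \<otimes> b \<otimes> inv (k \<otimes> b) = h \<otimes> inv k" if "h \<in> H" "k \<in> H" for h k
      using Hc[OF that(1)] Hc[OF that(2)] b
      by (simp add: inv_mult_group m_assoc[symmetric]) (simp add: m_assoc)
    have left: "h \<otimes> (k \<otimes> b) = h \<otimes> k \<otimes> b" if "h \<in> H" "k \<in> H" for h k
      using Hc[OF that(1)] Hc[OF that(2)] b by (simp add: m_assoc)
    from pq show "p \<otimes>\<^bsub>Dih\<^esub> q \<in> ?S"
      using mult by (auto simp: dihedral_simps swap cancel left)
  qed
qed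

end

theorem theorem2p6:
  fixes \<Gamma> :: "('a, 'b) monoid_scheme" and C :: "('a \<times> int) set"
  assumes "comm_group \<Gamma>"
    and "finite C"
    and "minimal_generating_set (generalized_dihedral \<Gamma>) C"
  shows "colorable (cayley_graph (generalized_dihedral \<Gamma>) C) 3"
proof -
  interpret comm_group \<Gamma> by (rule assms)
  interpret D: group Dih by (rule group_generalized_dihedral) (rule assms)
  have CD: "C \<subseteq> carrier Dih" and gen: "generate Dih C = carrier Dih"
    and minimal: "\<And>E. E \<subset> C \<Longrightarrow> generate Dih E \<noteq> carrier Dih"
    using assms(3) by (auto simp: minimal_generating_set_def)
  have whole: "S = carrier Dih" if "subgroup S Dih" "C \<subseteq> S" for S
    using D.generate_subgroup_incl[OF that(2,1)] subgroup.subset[OF that(1)] gen by blast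
  have C: "x \<in> carrier \<Gamma>" "s = 0 \<or> s = 1" if "(x, s) \<in> C" for x s
    using that CD by (auto simp: dihedral_simps dest!: subsetD)
  \<comment> \<open>The rotations form a proper subgroup, so they cannot contain the generating
    set.\<close>
  obtain b where b: "(b, 1) \<in> C"
  proof -
    have "subgroup (carrier \<Gamma> \<times> {0}) Dih"
      by (rule D.subgroupI) (auto simp: dihedral_simps inv_rotation)
    moreover have "(\<one>\<^bsub>\<Gamma>\<^esub>, 1) \<in> carrier Dih" by (simp add: dihedral_simps)
    ultimately have "\<not> C \<subseteq> carrier \<Gamma> \<times> {0}" using whole by fastforce
    then show ?thesis using C that by force
  qed
  have bc: "b \<in> carrier \<Gamma>" using b C by blast
  define J where "J = C - {(b, 1)}"
  \<comment> \<open>The family is indexed by members of \<open>C\<close>, so that an index also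
    determines its target in \<open>c\<close>: 1/2 for a rotation, 0 for a reflection.\<close>
  define e where "e = (\<lambda>(x, s). if s = (0::int) then x else x \<otimes>\<^bsub>\<Gamma>\<^esub> inv\<^bsub>\<Gamma>\<^esub> b)"
  define c where "c = (\<lambda>(x::'a, s). if s = (0::int) then 1/2 else (0::real))"
  have J: "finite J" using assms(2) by (simp add: J_def)
  have e: "e \<in> J \<rightarrow> carrier \<Gamma>"
    using C(1) bc by (fastforce simp: e_def J_def)
  have span: "carrier \<Gamma> \<subseteq> range (int_comb e J)"
  proof -
    let ?H = "range (int_comb e J)"
    \<comment> \<open>\<open>?S\<close> contains \<open>C\<close>, because a reflection
      \<open>(x, 1)\<close> has \<open>x\<close> equal to \<open>e (x, 1)\<close> times
      \<open>b\<close>. Hence \<open>?S\<close> is all of \<open>Dih\<close>, and its rotations give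
      the span.\<close>
    let ?S = "?H \<times> {0::int} \<union> (\<lambda>h. (h \<otimes>\<^bsub>\<Gamma>\<^esub> b, 1)) ` ?H"
    have H: "subgroup ?H \<Gamma>" by (rule subgroup_range_int_comb[OF e])
    have eH: "e j \<in> ?H" if "j \<in> J" for j
      using int_comb_single[OF e J that, of 1] e that
      by (metis (no_types, lifting) int_pow_1 PiE rangeI)
    have "p \<in> ?S" if p: "p \<in> C" for p
    proof (cases p)
      case (Pair x s)
      have x: "x \<in> carrier \<Gamma>" "s = 0 \<or> s = 1" using C p Pair by auto
      show ?thesis
      proof (cases "s = 0")
        case True
        then show ?thesis using eH[of p] p Pair by (auto simp: J_def e_def)
      next
        case False
        then have "x \<otimes>\<^bsub>\<Gamma>\<^esub> inv\<^bsub>\<Gamma>\<^esub> b \<in> ?H"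
          using eH[of p] p Pair bc subgroup.one_closed[OF H] by (cases "x = b") (auto simp: J_def e_def)
        moreover have "x = x \<otimes>\<^bsub>\<Gamma>\<^esub> inv\<^bsub>\<Gamma>\<^esub> b \<otimes>\<^bsub>\<Gamma>\<^esub> b" using x bc by (simp add: m_assoc)
        ultimately show ?thesis using Pair x False by blast
      qed
    qed
    then have S: "?S = carrier Dih"
      by (intro whole subgroup_rotations_reflections H bc subsetI)
    show ?thesis
    proof
      fix x assume "x \<in> carrier \<Gamma>"
      then have "(x, 0) \<in> ?S" unfolding S by (simp add: dihedral_simps)
      then show "x \<in> ?H" by (simp add: image_iff)
    qed
  qed
  have indep: "\<exists>H. subgroup H \<Gamma> \<and> e ` (J - {p}) \<subseteq> H \<and> e p \<notin> H" if p: "p \<in> J" for p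
  proof -
    define S where "S = generate Dih (C - {p})"
    have S: "subgroup S Dih" unfolding S_def using CD by (intro D.generate_is_subgroup) auto
    have CS: "C - {p} \<subseteq> S" unfolding S_def by (auto intro: generate.incl)
    have bS: "(b, 1) \<in> S" using b p CS by (auto simp: J_def)
    \<comment> \<open>Right multiplication by \<open>(b, 1)\<close>, which lies in \<open>S\<close>,
      exchanges the reflection \<open>(x, 1)\<close> with the rotation by
      \<open>e (x, 1)\<close>.\<close>
    have eS: "(e (x, s), 0) \<in> S \<longleftrightarrow> (x, s) \<in> S" if "(x, s) \<in> C" for x s
    proof (cases "s = 0")
      case False
      have x: "x \<in> carrier \<Gamma>" "s = 1" using C that False by auto
      have "(x, 1) \<otimes>\<^bsub>Dih\<^esub> (b, 1) = (e (x, s), 0)" "(e (x, s), 0) \<otimes>\<^bsub>Dih\<^esub> (b, 1) = (x, 1)"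
        using x bc by (simp_all add: dihedral_simps e_def m_assoc)
      then show ?thesis using subgroup.m_closed[OF S _ bS] x by metis
    qed (simp add: e_def)
    have "p \<notin> S"
    proof
      assume "p \<in> S"
      then have "S = carrier Dih" using CS S by (intro whole) auto
      then show False using minimal[of "C - {p}"] p by (auto simp: J_def S_def)
    qed
    then have "e p \<notin> {x. (x, 0) \<in> S}" using eS p by (cases p) (auto simp: J_def)
    moreover have "e ` (J - {p}) \<subseteq> {x. (x, 0) \<in> S}" using eS CS by (auto simp: J_def)
    ultimately show ?thesis using subgroup_rotations[OF S] by blast
  qed
  have half: "2 * c j \<in> \<int>" for j by (auto simp: c_def split: prod.split)
  obtain \<chi> where
      add: "\<And>x y. x \<in> carrier \<Gamma> \<Longrightarrow> y \<in> carrier \<Gamma> \<Longrightarrow> \<chi> (x \<otimes>\<^bsub>\<Gamma>\<^esub> y) - \<chi> x - \<chi> y \<in> \<int>"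
    and near: "\<And>j. j \<in> J \<Longrightarrow> \<exists>z. \<chi> (e j) - z \<in> \<int> \<and> \<bar>z - c j\<bar> \<le> 1/6"
    by (rule character_near_half_integers[OF e J span, of c]) (rule indep half that | assumption)+
  define F where "F = (\<lambda>(x, s). if s = (0::int) then \<chi> x else \<chi> (x \<otimes>\<^bsub>\<Gamma>\<^esub> inv\<^bsub>\<Gamma>\<^esub> b) + 1/2)"
  \<comment> \<open>The bound extends to \<open>(b, 1)\<close>, where \<open>e\<close> is the
    identity: additivity modulo 1 at the identity makes its value an integer, so
    \<open>z = 0\<close> serves.\<close>
  have near': "\<exists>z. \<chi> (e p) - z \<in> \<int> \<and> \<bar>z - c p\<bar> \<le> 1/6" if "p \<in> C" for p
  proof (cases "p = (b, 1)")
    case True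
    have "\<chi> \<one>\<^bsub>\<Gamma>\<^esub> \<in> \<int>" using add[of "\<one>\<^bsub>\<Gamma>\<^esub>" "\<one>\<^bsub>\<Gamma>\<^esub>"] by simp
    then show ?thesis using True bc by (intro exI[of _ 0]) (simp add: e_def c_def)
  qed (use near that in \<open>simp add: J_def\<close>)
  have edge: "third (F u) \<noteq> third (F (u \<otimes>\<^bsub>Dih\<^esub> p))" if u: "u \<in> carrier Dih" and p: "p \<in> C" for u p
  proof -
    obtain x s y r where xy: "u = (x, s)" "p = (y, r)" by (cases u; cases p)
    have x: "x \<in> carrier \<Gamma>" "s = 0 \<or> s = 1" using u xy by (auto simp: dihedral_simps)
    have y: "y \<in> carrier \<Gamma>" "r = 0 \<or> r = 1" using C p xy by auto
    have ep: "e p \<in> carrier \<Gamma>" using y bc xy by (auto simp: e_def)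
    obtain z where z: "\<chi> (e p) - z \<in> \<int>" "\<bar>z - c p\<bar> \<le> 1/6" using near' p by blast
    \<comment> \<open>Up to sign and modulo 1, the change of \<open>F\<close> along the edge. For a
      reflection the shift by 1/2 moves the target from 0 to 1/2.\<close>
    define z' where "z' = (if r = 0 then z else z + 1/2)"
    have z': "\<bar>z' - 1/2\<bar> \<le> 1/6" using z y xy by (auto simp: z'_def c_def)
    have step: "\<chi> (w \<otimes>\<^bsub>\<Gamma>\<^esub> e p) - \<chi> w - z \<in> \<int>" if "w \<in> carrier \<Gamma>" for w
      using Ints_add[OF add[OF that ep] z(1)] by (simp add: algebra_simps)
    consider "s = 0" "r = 0" | "s = 0" "r = 1" | "s = 1" "r = 0" | "s = 1" "r = 1"
      using x y by blast
    then show ?thesis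
    proof cases
      case 1
      then show ?thesis using step[OF x(1)] xy z'
        by (intro third_neq[of _ _ z']) (simp_all add: F_def dihedral_simps e_def z'_def)
    next
      case 2
      then show ?thesis using step[OF x(1)] xy z' x y bc
        by (intro third_neq[of _ _ z']) (simp_all add: F_def dihedral_simps e_def z'_def m_assoc
              algebra_simps)
    next
      case 3
      \<comment> \<open>From a reflection, multiplying by \<open>p\<close> subtracts in the first
        component. So \<open>step\<close> starts at the far endpoint and leads back, and
        \<open>third_neq\<close> is used with its arguments exchanged; likewise in the last
        case.\<close>
      have "x \<otimes>\<^bsub>\<Gamma>\<^esub> inv\<^bsub>\<Gamma>\<^esub> y \<otimes>\<^bsub>\<Gamma>\<^esub> inv\<^bsub>\<Gamma>\<^esub> b \<otimes>\<^bsub>\<Gamma>\<^esub> y = inv\<^bsub>\<Gamma>\<^esub> y \<otimes>\<^bsub>\<Gamma>\<^esub> y \<otimes>\<^bsub>\<Gamma>\<^esub> (x \<otimes>\<^bsub>\<Gamma>\<^esub> inv\<^bsub>\<Gamma>\<^esub> b)"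
        using x y bc by (simp only: m_ac m_closed inv_closed)
      then have "x \<otimes>\<^bsub>\<Gamma>\<^esub> inv\<^bsub>\<Gamma>\<^esub> y \<otimes>\<^bsub>\<Gamma>\<^esub> inv\<^bsub>\<Gamma>\<^esub> b \<otimes>\<^bsub>\<Gamma>\<^esub> y = x \<otimes>\<^bsub>\<Gamma>\<^esub> inv\<^bsub>\<Gamma>\<^esub> b"
        using x y bc by simp
      then show ?thesis
        using 3 step[of "x \<otimes>\<^bsub>\<Gamma>\<^esub> inv\<^bsub>\<Gamma>\<^esub> y \<otimes>\<^bsub>\<Gamma>\<^esub> inv\<^bsub>\<Gamma>\<^esub> b"] xy z' x y bc
        by (intro third_neq[of _ _ z', symmetric]) (simp_all add: F_def dihedral_simps e_def z'_def)
    next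
      case 4
      have "x \<otimes>\<^bsub>\<Gamma>\<^esub> inv\<^bsub>\<Gamma>\<^esub> y \<otimes>\<^bsub>\<Gamma>\<^esub> (y \<otimes>\<^bsub>\<Gamma>\<^esub> inv\<^bsub>\<Gamma>\<^esub> b) = inv\<^bsub>\<Gamma>\<^esub> y \<otimes>\<^bsub>\<Gamma>\<^esub> y \<otimes>\<^bsub>\<Gamma>\<^esub> (x \<otimes>\<^bsub>\<Gamma>\<^esub> inv\<^bsub>\<Gamma>\<^esub> b)"
        using x y bc by (simp only: m_ac m_closed inv_closed)
      then have "x \<otimes>\<^bsub>\<Gamma>\<^esub> inv\<^bsub>\<Gamma>\<^esub> y \<otimes>\<^bsub>\<Gamma>\<^esub> (y \<otimes>\<^bsub>\<Gamma>\<^esub> inv\<^bsub>\<Gamma>\<^esub> b) = x \<otimes>\<^bsub>\<Gamma>\<^esub> inv\<^bsub>\<Gamma>\<^esub> b"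
        using x y bc by simp
      then show ?thesis
        using 4 step[of "x \<otimes>\<^bsub>\<Gamma>\<^esub> inv\<^bsub>\<Gamma>\<^esub> y"] xy z' x y bc
        by (intro third_neq[of _ _ z', symmetric]) (simp_all add: F_def dihedral_simps e_def z'_def algebra_simps)
    qed
  qed
  show ?thesis
    unfolding colorable_def
  proof (intro exI[of _ "\<lambda>v. third (F v)"] conjI ballI)
    fix a assume "a \<in> parcs (cayley_graph Dih C)"
    then obtain u v where a: "a = (u, v)" and uv: "u \<in> carrier Dih" "v \<in> carrier Dih"
      and "inv\<^bsub>Dih\<^esub> u \<otimes>\<^bsub>Dih\<^esub> v \<in> C \<or> inv\<^bsub>Dih\<^esub> v \<otimes>\<^bsub>Dih\<^esub> u \<in> C"
      by (auto simp: cayley_graph_def)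
    \<comment> \<open>Either disjunct of adjacency writes one endpoint as the other times a member
      of \<open>C\<close>, which is the situation of \<open>edge\<close>.\<close>
    moreover have "x \<otimes>\<^bsub>Dih\<^esub> (inv\<^bsub>Dih\<^esub> x \<otimes>\<^bsub>Dih\<^esub> y) = y"
      if "x \<in> carrier Dih" "y \<in> carrier Dih" for x y
      using that by (simp add: D.m_assoc[symmetric])
    ultimately have "third (F u) \<noteq> third (F v)" using edge by metis
    then show "case a of (u, v) \<Rightarrow> third (F u) \<noteq> third (F v)" by (simp add: a)
  qed (rule third_less)
qed

end
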